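(* (i) There is an online algorithm with advice for the simple unbounded knapsack problem that reads only a single advice bit and has competitive ratio at most $3/2$. (ii) For any fixed number $k>0$, no online algorithm reading at most $k$ advice bits has competitive ratio less than $3/2$. (iii) For every $n$, any online algorithm with advice that achieves a competitive ratio better than $3/2$ on all instances of length at most $n$ must read more than $\log_2(n-1)$ advice bits (on some such instance).
   Context: Online simple unbounded knapsack problem: knapsack capacity $1$; an instance is a sequence of items $x_1,\dots,x_n$ ($n$ unknown to the algorithm) with sizes $s_i\in[0,1]$ and values $v_i=s_i$. Items arrive one by one; upon arrival of $x_i$ the algorithm irrevocably chooses a number $k_i\in\mathbb{N}_0$ of copies to pack, with the total packed size never exceeding $1$. $\mathrm{opt}(I)=\max\{\sum_i k_i v_i: k_i\in\mathbb{N}_0,\sum_i k_i s_i\le1\}$; the (strict) competitive ratio on $I$ is $\mathrm{opt}(I)/\mathrm{gain}(I)$ where $\mathrm{gain}(I)$ is the total packed value, and the competitive ratio of an algorithm is its supremum over instances. Advice model (tape model): before processing, an oracle that knows the whole instance writes an infinite binary advice string; the deterministic online algorithm may read bits of this string from the beginning. An algorithm uses $f(n)$ advice bits if on every instance with $n$ items it reads at most the first $f(n)$ bits. Its competitive ratio is computed with the oracle supplying the best advice for each instance. *)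

theory Defs
  imports Complex_Main "HOL-Library.FuncSet" "HOL-Library.Extended_Real"
begin

text \<open>In the simple problem the value of an item equals its size, so an item is represented
  by its size and an instance by the list of sizes in order of arrival.\<close>

definition valid_instance :: "real list \<Rightarrow> bool" where
  "valid_instance xs \<longleftrightarrow> set xs \<subseteq> {0..1}"

definition total :: "real list \<Rightarrow> (nat \<Rightarrow> nat) \<Rightarrow> real" where
  "total xs k = (\<Sum>i<length xs. real (k i) * xs ! i)"

definition opt :: "real list \<Rightarrow> real" where
  "opt xs = Max {total xs k | k. total xs k \<le> 1}"

text \<open>The maximum in \<^const>\<open>opt\<close> is over a finite nonempty set of values, although an item of
  size 0 may be packed arbitrarily often.\<close>

lemma finite_feasible_totals:
  assumes "valid_instance xs"
  shows "finite {total xs k | k. total xs k \<le> 1}"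
proof -
  define B where "B i = nat \<lfloor>1 / xs ! i\<rfloor>" for i
  define P where "P = (\<Pi>\<^sub>E i\<in>{..<length xs}. {..B i})"
  have nonneg: "0 \<le> xs ! i" if "i < length xs" for i
    using assms nth_mem[OF that] unfolding valid_instance_def by (meson atLeastAtMost_iff subsetD)
  have "total xs k \<in> total xs ` P" if k: "total xs k \<le> 1" for k
  proof -
    define k' where "k' = (\<lambda>i\<in>{..<length xs}. if xs ! i = 0 then 0 else k i)"
    have eq: "total xs k' = total xs k"
      unfolding total_def k'_def by (intro sum.cong) auto
    have "k i \<le> B i" if i: "i < length xs" "xs ! i \<noteq> 0" for i
    proof -
      have pos: "xs ! i > 0" using nonneg[OF i(1)] i(2) by simp
      have "real (k i) * xs ! i \<le> total xs k"
        unfolding total_def using i(1) nonneg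
        by (intro member_le_sum[where f = "\<lambda>j. real (k j) * xs ! j"]) auto
      with k have "real (k i) * xs ! i \<le> 1" by linarith
      then have "real (k i) \<le> 1 / xs ! i" using pos by (simp add: field_simps)
      then show ?thesis unfolding B_def by (simp add: le_nat_floor)
    qed
    then have "k' \<in> P" unfolding P_def k'_def by auto
    with eq show ?thesis by (metis imageI)
  qed
  then have "{total xs k | k. total xs k \<le> 1} \<subseteq> total xs ` P" by auto
  moreover have "finite (total xs ` P)" unfolding P_def by (intro finite_imageI finite_PiE) auto
  ultimately show ?thesis by (rule finite_subset)
qed

lemma feasible_totals_nonempty: "{total xs k | k. total xs k \<le> 1} \<noteq> {}"
proof -
  have "total xs (\<lambda>_. 0) \<le> 1" by (simp add: total_def)
  then show ?thesis by blast
qed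

type_synonym tape = "nat \<Rightarrow> bool"

datatype action = Read_Bit | Pack (copies: nat)

text \<open>A deterministic online algorithm maps the items seen so far (the current item last) and
  the advice bits read so far to its next action: read one more bit of the tape, or pack a number
  of copies of the current item and so finish its processing. Its earlier decisions are determined
  by these two arguments.\<close>

type_synonym algorithm = "real list \<Rightarrow> bool list \<Rightarrow> action"

text \<open>\<open>bits_after A \<phi> xs i\<close> is the number of bits read once the first \<open>i\<close> items have been processed,
  and \<open>halts A \<phi> xs\<close> says that on every item the reading stops; only then is the
  \<open>LEAST\<close> below meaningful.\<close>

fun bits_after :: "algorithm \<Rightarrow> tape \<Rightarrow> real list \<Rightarrow> nat \<Rightarrow> nat" where
  "bits_after A \<phi> xs 0 = 0"
| "bits_after A \<phi> xs (Suc i) =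
     (LEAST m. bits_after A \<phi> xs i \<le> m \<and> A (take (Suc i) xs) (map \<phi> [0..<m]) \<noteq> Read_Bit)"

definition halts :: "algorithm \<Rightarrow> tape \<Rightarrow> real list \<Rightarrow> bool" where
  "halts A \<phi> xs \<longleftrightarrow>
     (\<forall>i<length xs. \<exists>m\<ge>bits_after A \<phi> xs i. A (take (Suc i) xs) (map \<phi> [0..<m]) \<noteq> Read_Bit)"

definition bits_read :: "algorithm \<Rightarrow> tape \<Rightarrow> real list \<Rightarrow> nat" where
  "bits_read A \<phi> xs = bits_after A \<phi> xs (length xs)"

definition packed :: "algorithm \<Rightarrow> tape \<Rightarrow> real list \<Rightarrow> nat \<Rightarrow> nat" where
  "packed A \<phi> xs i = copies (A (take (Suc i) xs) (map \<phi> [0..<bits_after A \<phi> xs (Suc i)]))"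

definition gain :: "algorithm \<Rightarrow> tape \<Rightarrow> real list \<Rightarrow> real" where
  "gain A \<phi> xs = total xs (packed A \<phi> xs)"

text \<open>The oracle chooses the tape from the whole instance. It is kept as an explicit parameter:
  an existential statement over oracles is witnessed by the best one, and a universal statement
  covers the best one. Only the runs on the tapes written by the oracle have to halt and respect
  the capacity, so that, for instance, self-delimiting advice, which has non-halting runs on
  malformed tapes, is admitted. As sizes are nonnegative, a final total of at most 1 means that
  the capacity is never exceeded.\<close>

type_synonym advice_oracle = "real list \<Rightarrow> tape"

definition online_algorithm_with_advice :: "algorithm \<Rightarrow> advice_oracle \<Rightarrow> bool" where
  "online_algorithm_with_advice A orc \<longleftrightarrow>
     (\<forall>xs. valid_instance xs \<longrightarrow> halts A (orc xs) xs \<and> gain A (orc xs) xs \<le> 1)"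

definition uses_advice_bits :: "algorithm \<Rightarrow> advice_oracle \<Rightarrow> (nat \<Rightarrow> nat) \<Rightarrow> bool" where
  "uses_advice_bits A orc f \<longleftrightarrow>
     (\<forall>xs. valid_instance xs \<longrightarrow> bits_read A (orc xs) xs \<le> f (length xs))"

text \<open>Division by zero: gain 0 gives ratio \<open>\<infinity>\<close> if the optimum is positive, and ratio 1 if the
  optimum is 0 as well.\<close>

definition ratio_on :: "algorithm \<Rightarrow> tape \<Rightarrow> real list \<Rightarrow> ereal" where
  "ratio_on A \<phi> xs =
     (if gain A \<phi> xs = 0 then (if opt xs = 0 then 1 else \<infinity>) else ereal (opt xs / gain A \<phi> xs))"

definition competitive_ratio_within ::
    "real list set \<Rightarrow> algorithm \<Rightarrow> advice_oracle \<Rightarrow> ereal" where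
  "competitive_ratio_within S A orc = (SUP xs\<in>S. ratio_on A (orc xs) xs)"

definition competitive_ratio :: "algorithm \<Rightarrow> advice_oracle \<Rightarrow> ereal" where
  "competitive_ratio = competitive_ratio_within {xs. valid_instance xs}"

end

theory Submission
  imports Defs
begin

text \<open>Upper bound: call an item good if copies of it alone fill the knapsack up to at least 2/3.
  A nonzero item that is not good has its size strictly between 1/2 and 2/3, so without good items
  the optimum is below 2/3 and packing any one nonzero item gives more than 1/2. The
  single advice bit says whether a good item will appear.

  Lower bound: let \<open>x\<^sub>0 > x\<^sub>1 > \<dots>\<close> be sizes slightly above 1/3. On \<open>x\<^sub>0\<close> alone, two copies must be
  packed. On \<open>x\<^sub>0, \<dots>, x\<^sub>i, 1 - x\<^sub>i\<close> the optimum is 1, and every packing other than one copy each of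
  \<open>x\<^sub>i\<close> and \<open>1 - x\<^sub>i\<close> gives not much more than 2/3. Any two of these instances force different
  decisions on a common prefix, so they need different advice.\<close>

section \<open>General facts\<close>

lemma total_le_opt:
  assumes "valid_instance xs" "total xs k \<le> 1"
  shows "total xs k \<le> opt xs"
  unfolding opt_def using assms by (intro Max_ge finite_feasible_totals) auto

lemma opt_leI:
  assumes "valid_instance xs" "\<And>k. total xs k \<le> 1 \<Longrightarrow> total xs k \<le> c"
  shows "opt xs \<le> c"
  unfolding opt_def
  by (subst Max_le_iff[OF finite_feasible_totals[OF assms(1)] feasible_totals_nonempty])
    (use assms(2) in auto)

lemma opt_le_1: "valid_instance xs \<Longrightarrow> opt xs \<le> 1"
  by (rule opt_leI)

lemma opt_nonneg: "valid_instance xs \<Longrightarrow> 0 \<le> opt xs"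
  using total_le_opt[of xs "\<lambda>_. 0"] by (simp add: total_def)

lemma valid_instance_nth:
  assumes "valid_instance xs" "i < length xs"
  shows "0 \<le> xs ! i" "xs ! i \<le> 1"
  using assms nth_mem[OF assms(2)] unfolding valid_instance_def by (meson atLeastAtMost_iff subsetD)+

lemma total_eq_single:
  assumes "i < length xs" "\<And>j. j < length xs \<Longrightarrow> j \<noteq> i \<Longrightarrow> real (k j) * xs ! j = 0"
  shows "total xs k = real (k i) * xs ! i"
proof -
  have "total xs k = (\<Sum>j<length xs. if j = i then real (k i) * xs ! i else 0)"
    unfolding total_def using assms(2) by (intro sum.cong) auto
  also have "\<dots> = real (k i) * xs ! i"
    using assms(1) by simp
  finally show ?thesis .
qed

lemma pair_le_total:
  assumes "valid_instance xs" "i < length xs" "j < length xs" "i \<noteq> j"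
  shows "real (k i) * xs ! i + real (k j) * xs ! j \<le> total xs k"
proof -
  have "(\<Sum>l\<in>{i, j}. real (k l) * xs ! l) \<le> total xs k"
    unfolding total_def using assms valid_instance_nth by (intro sum_mono2) auto
  with assms(4) show ?thesis by simp
qed

section \<open>One advice bit suffices for ratio 3/2\<close>

definition fill :: "real \<Rightarrow> nat" where
  "fill s = nat \<lfloor>1 / s\<rfloor>"

text \<open>Since \<open>1 / 0 = 0\<close>, \<open>fill 0 = 0\<close>, so an item of size 0 is never
  good.\<close>

definition good :: "real \<Rightarrow> bool" where
  "good s \<longleftrightarrow> real (fill s) * s \<ge> 2 / 3"

definition target :: "bool \<Rightarrow> real \<Rightarrow> bool" where
  "target b s \<longleftrightarrow> (if b then good s else s \<noteq> 0)"

text \<open>The bit is requested at the first item and remains visible afterwards. Whether the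
  knapsack is still empty is reconstructed from the earlier items: it is empty as long as none of
  them was a target.\<close>

definition one_bit_alg :: algorithm where
  "one_bit_alg xs bs =
     (if bs = [] then Read_Bit
      else Pack (if target (hd bs) (last xs) \<and> (\<forall>y\<in>set (butlast xs). \<not> target (hd bs) y)
                 then fill (last xs) else 0))"

text \<open>The tape is constant, since only its bit 0 is ever inspected.\<close>

definition good_oracle :: advice_oracle where
  "good_oracle xs = (\<lambda>_. \<exists>x\<in>set xs. good x)"

lemma fill_le_1: "0 \<le> s \<Longrightarrow> real (fill s) * s \<le> 1"
proof (cases "s = 0")
  case False
  assume "0 \<le> s"
  with False have "real (fill s) \<le> 1 / s" unfolding fill_def by simp
  with False \<open>0 \<le> s\<close> show ?thesis by (simp add: field_simps)
qed simp

lemma fill_eq_1: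
  assumes "1 / 2 < s" "s \<le> 1"
  shows "fill s = 1"
proof -
  have "\<lfloor>1 / s\<rfloor> = 1" using assms by (intro floor_unique) (auto simp: field_simps)
  then show ?thesis by (simp add: fill_def)
qed

text \<open>Rounding loses less than one copy, so \<open>fill s\<close> copies cover more than
  \<open>1 - s\<close>, which is at least 2/3 for \<open>s \<le> 1 / 3\<close>. Between 1/3 and 1/2
  two copies fit and cover more than 2/3. Above 1/2 only a single copy fits, and being not good then
  means \<open>s < 2 / 3\<close>.\<close>

lemma not_good_bounds:
  assumes "0 < s" "s \<le> 1" "\<not> good s"
  shows "1 / 2 < s" "s < 2 / 3"
proof -
  have fill: "real (fill s) * s > 1 - s"
  proof -
    have "0 \<le> \<lfloor>1 / s\<rfloor>" using assms(1) by simp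
    then have "real (fill s) = real_of_int \<lfloor>1 / s\<rfloor>"
      unfolding fill_def by (simp only: of_nat_nat)
    then have "real (fill s) > 1 / s - 1" by linarith
    then show ?thesis using assms(1) by (simp add: field_simps)
  qed
  show "1 / 2 < s"
  proof (rule ccontr)
    assume s: "\<not> 1 / 2 < s"
    show False
    proof (cases "s \<le> 1 / 3")
      case True
      then show False using fill assms(3) unfolding good_def by linarith
    next
      case False
      have "2 \<le> fill s"
        unfolding fill_def using s assms(1) by (simp add: le_nat_iff le_floor_iff field_simps)
      then have "2 * s \<le> real (fill s) * s" using assms(1) by (intro mult_right_mono) auto
      then show False using False assms(3) unfolding good_def by linarith
    qed
  qed
  then show "s < 2 / 3"
    using assms(2,3) fill_eq_1[of s] unfolding good_def by simp
qed

text \<open>Every copy of nonzero size exceeds 1/2, so a feasible packing holds at most one of them,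
  and its size is below 2/3.\<close>

lemma opt_le_without_good:
  assumes v: "valid_instance xs" and ng: "\<forall>x\<in>set xs. \<not> good x"
  shows "opt xs \<le> 2 / 3"
proof (rule opt_leI[OF v])
  fix k assume k: "total xs k \<le> 1"
  have half: "real (k i) * xs ! i > 1 / 2 \<and> xs ! i > 1 / 2 \<and> xs ! i < 2 / 3"
    if i: "i < length xs" "real (k i) * xs ! i \<noteq> 0" for i
  proof -
    have "xs ! i \<noteq> 0" using i(2) by simp
    then have "xs ! i > 0" using valid_instance_nth(1)[OF v i(1)] by linarith
    moreover have "\<not> good (xs ! i)" using ng i(1) by simp
    ultimately have b: "1 / 2 < xs ! i" "xs ! i < 2 / 3"
      using not_good_bounds[OF _ valid_instance_nth(2)[OF v i(1)]] by blast+
    have "1 * xs ! i \<le> real (k i) * xs ! i" using i(2) b by (intro mult_right_mono) auto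
    with b show ?thesis by linarith
  qed
  show "total xs k \<le> 2 / 3"
  proof (cases "\<exists>i<length xs. real (k i) * xs ! i \<noteq> 0")
    case True
    then obtain i where i: "i < length xs" "real (k i) * xs ! i \<noteq> 0" by blast
    have "real (k j) * xs ! j = 0" if j: "j < length xs" "j \<noteq> i" for j
    proof (rule ccontr)
      assume "real (k j) * xs ! j \<noteq> 0"
      then have "1 / 2 < real (k j) * xs ! j" "1 / 2 < real (k i) * xs ! i"
        using half i j(1) by blast+
      then show False using pair_le_total[OF v i(1) j(1) j(2)[symmetric], of k] k by linarith
    qed
    then have eq: "total xs k = real (k i) * xs ! i" by (rule total_eq_single[OF i(1)])
    have "k i < 2"
    proof (rule ccontr)
      assume "\<not> k i < 2"
      then have "2 * xs ! i \<le> real (k i) * xs ! i" using half[OF i] by (intro mult_right_mono) auto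
      then show False using half[OF i] eq k by linarith
    qed
    then have "k i = 1" using i(2) by (cases "k i") auto
    then show ?thesis using eq half[OF i] by simp
  next
    case False
    then have "total xs k = 0" unfolding total_def by (intro sum.neutral) blast
    then show ?thesis by simp
  qed
qed

section \<open>Runs of the one-bit algorithm\<close>

lemma bits_after_one_bit_alg: "bits_after one_bit_alg \<phi> xs i = (if i = 0 then 0 else 1)"
proof (induction i)
  case (Suc i)
  then show ?case
    by (auto intro!: Least_equality simp: one_bit_alg_def Suc_le_eq split: if_splits)
qed simp

lemma halts_one_bit_alg: "halts one_bit_alg \<phi> xs"
  unfolding halts_def bits_after_one_bit_alg by (auto intro!: exI[of _ 1] simp: one_bit_alg_def)

lemma packed_one_bit_alg:
  assumes "i < length xs"
  shows "packed one_bit_alg \<phi> xs i =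
    (if target (\<phi> 0) (xs ! i) \<and> (\<forall>j<i. \<not> target (\<phi> 0) (xs ! j)) then fill (xs ! i) else 0)"
proof -
  have "take (Suc i) xs = take i xs @ [xs ! i]" using assms by (rule take_Suc_conv_app_nth)
  moreover have "(\<forall>y\<in>set (take i xs). \<not> target (\<phi> 0) y) \<longleftrightarrow> (\<forall>j<i. \<not> target (\<phi> 0) (xs ! j))"
    using assms by (auto simp: set_conv_nth)
  ultimately show ?thesis
    by (simp add: packed_def bits_after_one_bit_alg one_bit_alg_def del: bits_after.simps) blast
qed

lemma gain_one_bit_alg_no_target:
  assumes "\<forall>x\<in>set xs. \<not> target (\<phi> 0) x"
  shows "gain one_bit_alg \<phi> xs = 0"
  unfolding gain_def total_def using assms by (auto simp: packed_one_bit_alg)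

text \<open>The obtained \<open>x\<close> is the first target item; no other item is packed.\<close>

lemma gain_one_bit_alg_target:
  assumes "\<exists>x\<in>set xs. target (\<phi> 0) x"
  obtains x where "x \<in> set xs" "target (\<phi> 0) x" "gain one_bit_alg \<phi> xs = real (fill x) * x"
proof -
  define P where "P i \<longleftrightarrow> i < length xs \<and> target (\<phi> 0) (xs ! i)" for i
  define i where "i = (LEAST i. P i)"
  have "\<exists>i. P i" using assms by (auto simp: P_def in_set_conv_nth)
  then have i: "P i" unfolding i_def by (rule LeastI_ex)
  have least: "\<not> P j" if "j < i" for j using that unfolding i_def by (rule not_less_Least)
  have "packed one_bit_alg \<phi> xs j = 0" if "j < length xs" "j \<noteq> i" for j
    using i least that by (cases "j < i") (auto simp: packed_one_bit_alg P_def)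
  then have "gain one_bit_alg \<phi> xs = real (packed one_bit_alg \<phi> xs i) * xs ! i"
    unfolding gain_def using i by (intro total_eq_single) (auto simp: P_def)
  moreover have "packed one_bit_alg \<phi> xs i = fill (xs ! i)"
    using i least by (auto simp: packed_one_bit_alg P_def)
  ultimately show ?thesis
    using that[of "xs ! i"] i by (auto simp: P_def)
qed

lemma gain_one_bit_alg_le_1:
  assumes "valid_instance xs"
  shows "gain one_bit_alg \<phi> xs \<le> 1"
proof (cases "\<exists>x\<in>set xs. target (\<phi> 0) x")
  case True
  then obtain x where "x \<in> set xs" "gain one_bit_alg \<phi> xs = real (fill x) * x"
    by (rule gain_one_bit_alg_target)
  then show ?thesis using fill_le_1[of x] assms by (auto simp: valid_instance_def)
qed (simp add: gain_one_bit_alg_no_target)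

lemma ratio_one_bit_alg:
  assumes v: "valid_instance xs"
  shows "ratio_on one_bit_alg (good_oracle xs) xs \<le> ereal (3 / 2)"
proof -
  let ?g = "gain one_bit_alg (good_oracle xs) xs"
  have conclude: ?thesis if "0 < ?g" "opt xs \<le> 3 / 2 * ?g"
    using that by (simp add: ratio_on_def pos_divide_le_eq)
  show ?thesis
  proof (cases "\<exists>x\<in>set xs. target (good_oracle xs 0) x")
    case True
    then obtain x where x: "x \<in> set xs" "target (good_oracle xs 0) x" "?g = real (fill x) * x"
      by (rule gain_one_bit_alg_target)
    show ?thesis
    proof (cases "\<exists>x\<in>set xs. good x")
      case True
      then have "?g \<ge> 2 / 3" using x by (simp add: target_def good_oracle_def good_def)
      then show ?thesis using opt_le_1[OF v] by (intro conclude) auto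
    next
      case False
      then have "x \<noteq> 0" using x by (simp add: target_def good_oracle_def)
      then have "0 < x" "x \<le> 1" using x(1) v by (auto simp: valid_instance_def less_le)
      moreover from this have "1 / 2 < x" using False x(1) not_good_bounds(1) by blast
      ultimately have "?g > 1 / 2" using x(3) fill_eq_1[of x] by simp
      moreover have "opt xs \<le> 2 / 3" using opt_le_without_good[OF v] False by blast
      ultimately show ?thesis by (intro conclude) auto
    qed
  next
    case False
    \<comment> \<open>A set bit would announce a good item, which is a target. So the bit is unset
      and all sizes are 0; gain and optimum both vanish, which counts as ratio 1.\<close>
    then have "\<forall>x\<in>set xs. x = 0"
      by (auto simp: target_def good_oracle_def split: if_splits)
    then have "total xs k = 0" for k
      by (auto simp: total_def intro!: sum.neutral dest: nth_mem)
    then have "opt xs \<le> 0" by (intro opt_leI[OF v]) simp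
    then have "opt xs = 0" using opt_nonneg[OF v] by simp
    moreover have "?g = 0" using gain_one_bit_alg_no_target False by blast
    ultimately show ?thesis by (simp add: ratio_on_def)
  qed
qed

lemma one_bit_upper_bound:
  "\<exists>A orc. online_algorithm_with_advice A orc \<and> uses_advice_bits A orc (\<lambda>_. 1) \<and>
     competitive_ratio A orc \<le> ereal (3 / 2)"
proof (intro exI conjI)
  show "online_algorithm_with_advice one_bit_alg good_oracle"
    by (simp add: online_algorithm_with_advice_def halts_one_bit_alg gain_one_bit_alg_le_1)
  show "uses_advice_bits one_bit_alg good_oracle (\<lambda>_. 1)"
    by (simp add: uses_advice_bits_def bits_read_def bits_after_one_bit_alg)
  show "competitive_ratio one_bit_alg good_oracle \<le> ereal (3 / 2)"
    unfolding competitive_ratio_def competitive_ratio_within_def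
    by (intro SUP_least) (simp add: ratio_one_bit_alg)
qed

section \<open>Fewer bits do not suffice for a smaller ratio\<close>

lemma bits_after_Suc:
  assumes "halts A \<phi> xs" "i < length xs"
  shows "bits_after A \<phi> xs i \<le> bits_after A \<phi> xs (Suc i)"
    and "A (take (Suc i) xs) (map \<phi> [0..<bits_after A \<phi> xs (Suc i)]) \<noteq> Read_Bit"
proof -
  have "\<exists>m\<ge>bits_after A \<phi> xs i. A (take (Suc i) xs) (map \<phi> [0..<m]) \<noteq> Read_Bit"
    using assms unfolding halts_def by blast
  \<comment> \<open>Halting makes the \<open>LEAST\<close> in \<open>bits_after\<close> an attained
    minimum.\<close>
  from LeastI_ex[OF this]
  show "bits_after A \<phi> xs i \<le> bits_after A \<phi> xs (Suc i)"
    and "A (take (Suc i) xs) (map \<phi> [0..<bits_after A \<phi> xs (Suc i)]) \<noteq> Read_Bit"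
    by simp_all
qed

lemma bits_after_le_bits_read:
  assumes "halts A \<phi> xs" "i \<le> length xs"
  shows "bits_after A \<phi> xs i \<le> bits_read A \<phi> xs"
  using assms(2) unfolding bits_read_def
proof (induction rule: inc_induct)
  case (step n)
  then show ?case using bits_after_Suc(1)[OF assms(1), of n] by linarith
qed simp

text \<open>Both runs see the same items and the same bits below \<open>b\<close>. So the stopping
  point of each run is also admissible for the other, and the two minima coincide.\<close>

lemma bits_after_cong:
  assumes \<phi>: "halts A \<phi> xs" "bits_read A \<phi> xs \<le> b"
    and \<psi>: "halts A \<psi> ys" "bits_read A \<psi> ys \<le> b"
    and tape: "map \<phi> [0..<b] = map \<psi> [0..<b]"
    and i: "i \<le> length xs" "i \<le> length ys" "take i xs = take i ys"
  shows "bits_after A \<phi> xs i = bits_after A \<psi> ys i"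
  using i
proof (induction i)
  case (Suc i)
  have prefix: "map \<phi> [0..<m] = map \<psi> [0..<m]" if "m \<le> b" for m
    using tape that by (auto simp: map_eq_conv)
  have "take i xs = take i (take (Suc i) xs)" by simp
  also have "\<dots> = take i ys" using Suc.prems(3) by simp
  finally have IH: "bits_after A \<phi> xs i = bits_after A \<psi> ys i"
    using Suc by simp
  note bits_after.simps(2)[simp del]
  let ?m = "bits_after A \<phi> xs (Suc i)" and ?m' = "bits_after A \<psi> ys (Suc i)"
  have bounds: "?m \<le> b" "?m' \<le> b"
    using bits_after_le_bits_read[OF \<phi>(1) Suc.prems(1)] \<phi>(2)
      bits_after_le_bits_read[OF \<psi>(1) Suc.prems(2)] \<psi>(2) by linarith+
  have m: "bits_after A \<phi> xs i \<le> ?m" "A (take (Suc i) xs) (map \<phi> [0..<?m]) \<noteq> Read_Bit"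
    using bits_after_Suc[OF \<phi>(1)] Suc.prems(1) by simp_all
  have m': "bits_after A \<psi> ys i \<le> ?m'" "A (take (Suc i) ys) (map \<psi> [0..<?m']) \<noteq> Read_Bit"
    using bits_after_Suc[OF \<psi>(1)] Suc.prems(2) by simp_all
  have "?m \<le> ?m'"
  proof -
    have "A (take (Suc i) xs) (map \<phi> [0..<?m']) \<noteq> Read_Bit"
      unfolding Suc.prems(3) prefix[OF bounds(2)] by (rule m'(2))
    then show ?thesis
      unfolding bits_after.simps(2)[of A \<phi>] using m'(1) IH by (intro Least_le conjI) auto
  qed
  moreover have "?m' \<le> ?m"
  proof -
    have "A (take (Suc i) ys) (map \<psi> [0..<?m]) \<noteq> Read_Bit"
      unfolding Suc.prems(3)[symmetric] prefix[OF bounds(1), symmetric] by (rule m(2))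
    then show ?thesis
      unfolding bits_after.simps(2)[of A \<psi>] using m(1) IH by (intro Least_le conjI) auto
  qed
  ultimately show ?case by (rule antisym)
qed simp

text \<open>This is the indistinguishability used by the pigeonhole argument: equal advice prefixes
  force equal decisions as long as the items agree.\<close>

lemma packed_cong:
  assumes \<phi>: "halts A \<phi> xs" "bits_read A \<phi> xs \<le> b"
    and \<psi>: "halts A \<psi> ys" "bits_read A \<psi> ys \<le> b"
    and tape: "map \<phi> [0..<b] = map \<psi> [0..<b]"
    and i: "i < length xs" "i < length ys" "take (Suc i) xs = take (Suc i) ys"
  shows "packed A \<phi> xs i = packed A \<psi> ys i"
proof -
  have eq: "bits_after A \<phi> xs (Suc i) = bits_after A \<psi> ys (Suc i)"
    using assms by (intro bits_after_cong) auto
  have "bits_after A \<phi> xs (Suc i) \<le> b"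
    using bits_after_le_bits_read[OF \<phi>(1), of "Suc i"] i(1) \<phi>(2) by simp
  then have "map \<phi> [0..<bits_after A \<phi> xs (Suc i)] = map \<psi> [0..<bits_after A \<phi> xs (Suc i)]"
    using tape by (auto simp: map_eq_conv)
  then show ?thesis unfolding packed_def eq[symmetric] i(3) by (simp only:)
qed

text \<open>Zero gain against a positive optimum has ratio \<infinity>, so a finite bound excludes
  it and the quotient can be cleared.\<close>

lemma opt_le_of_ratio_le:
  assumes "ratio_on A \<phi> xs \<le> ereal c" "0 < opt xs" "0 \<le> gain A \<phi> xs"
  shows "opt xs \<le> c * gain A \<phi> xs" "0 < gain A \<phi> xs"
  using assms by (auto simp: ratio_on_def pos_divide_le_eq less_le split: if_splits)

lemma gain_nonneg: "valid_instance xs \<Longrightarrow> 0 \<le> gain A \<phi> xs"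
  unfolding gain_def total_def by (intro sum_nonneg mult_nonneg_nonneg) (auto simp: valid_instance_nth)

section \<open>Hard instances and their forced packings\<close>

definition hard_size :: "real \<Rightarrow> nat \<Rightarrow> real" where
  "hard_size d j = 1 / 3 + d / (real j + 1)"

text \<open>The complement of item \<open>i\<close> ends instance \<open>Suc i\<close>. With this
  shift instance \<open>i\<close> has length \<open>Suc i\<close>, so the \<open>n\<close> instances
  with index below \<open>n\<close> all have length at most \<open>n\<close>.\<close>

fun hard_instance :: "real \<Rightarrow> nat \<Rightarrow> real list" where
  "hard_instance d 0 = [hard_size d 0]"
| "hard_instance d (Suc i) = map (hard_size d) [0..<Suc i] @ [1 - hard_size d i]"

lemma hard_size_bounds:
  assumes "0 < d"
  shows "1 / 3 < hard_size d j" "hard_size d j \<le> 1 / 3 + d"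
  using assms by (auto simp: hard_size_def field_simps)

text \<open>Strict decrease ensures that no item before item \<open>i\<close> fits beside
  \<open>1 - hard_size d i\<close>.\<close>

lemma hard_size_less: "0 < d \<Longrightarrow> i < j \<Longrightarrow> hard_size d j < hard_size d i"
  by (auto simp: hard_size_def intro!: divide_strict_left_mono)

lemma length_hard_instance: "length (hard_instance d i) = Suc i"
  by (cases i) auto

lemma valid_hard_instance:
  assumes "0 < d" "d \<le> 1 / 12"
  shows "valid_instance (hard_instance d i)"
proof -
  have "hard_size d j \<in> {0..1}" "1 - hard_size d j \<in> {0..1}" for j
    using hard_size_bounds[OF assms(1), of j] assms(2) by auto
  then show ?thesis unfolding valid_instance_def by (cases i) auto
qed

text \<open>\<open>max 1 i\<close> counts the items of instance \<open>i\<close> other than a final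
  complement; instance 0 has one such item and no complement.\<close>

lemma nth_hard_instance:
  assumes "j < max 1 i"
  shows "hard_instance d i ! j = hard_size d j"
  using assms by (cases i) (auto simp: nth_append simp del: upt_Suc)

lemma nth_hard_instance_last: "hard_instance d (Suc i) ! Suc i = 1 - hard_size d i"
  by (auto simp: nth_append simp del: upt_Suc)

lemma take_hard_instance:
  assumes "i < j"
  shows "take (max 1 i) (hard_instance d i) = take (max 1 i) (hard_instance d j)"
  by (rule nth_equalityI)
    (use assms in \<open>auto simp: length_hard_instance nth_hard_instance\<close>)

text \<open>Let \<open>s\<close> count the copies of items near 1/3. Without the complement,
  \<open>s \<le> 2\<close> yields at most \<open>2 / 3 + 2 * d\<close> and \<open>s \<ge> 3\<close>
  overflows. Two complements overflow as well. With exactly one, the room left is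
  \<open>hard_size d i\<close>: earlier items are too large for it, two copies of item
  \<open>i\<close> do not fit, and leaving it empty yields less than 2/3.\<close>

lemma packing_hard_instance_Suc:
  assumes d: "0 < d" "d \<le> 1 / 12"
    and k: "total (hard_instance d (Suc i)) k \<le> 1" "2 / 3 + 2 * d < total (hard_instance d (Suc i)) k"
    and j: "j \<le> i"
  shows "k j = (if j = i then 1 else 0)"
proof -
  let ?x = "hard_size d"
  define s where "s = (\<Sum>j<Suc i. k j)"
  define t where "t = (\<Sum>j<Suc i. real (k j) * ?x j)"
  define l where "l = real (k (Suc i)) * (1 - ?x i)"
  note b = hard_size_bounds[OF d(1)]
  have pos: "0 < ?x j" for j using b(1)[of j] by linarith
  have total: "total (hard_instance d (Suc i)) k = t + l"
    unfolding total_def t_def l_def length_hard_instance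
    by (subst sum.lessThan_Suc) (simp add: nth_hard_instance nth_hard_instance_last
        del: hard_instance.simps sum.lessThan_Suc)
  have lower: "real s * (1 / 3) \<le> t"
    unfolding s_def t_def of_nat_sum sum_distrib_right using b(1)
    by (intro sum_mono mult_left_mono) (auto intro: less_imp_le)
  have upper: "t \<le> real s * (1 / 3 + d)"
    unfolding s_def t_def of_nat_sum sum_distrib_right using b(2)
    by (intro sum_mono mult_left_mono) auto
  have "k (Suc i) < 2"
  proof (rule ccontr)
    assume "\<not> k (Suc i) < 2"
    then have "2 * (1 - ?x i) \<le> l" unfolding l_def using b(2)[of i] d(2)
      by (intro mult_right_mono) auto
    then have "1 < l" using b(2)[of i] d(2) by argo
    moreover have "0 \<le> real s * (1 / 3)" by simp
    then have "0 \<le> t" using lower by linarith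
    ultimately show False using total k(1) by linarith
  qed
  moreover have "k (Suc i) \<noteq> 0"
  proof
    assume k0: "k (Suc i) = 0"
    have "s \<ge> 3"
    proof (rule ccontr)
      assume "\<not> 3 \<le> s"
      then have "real s * (1 / 3 + d) \<le> 2 * (1 / 3 + d)"
        using d(1) by (intro mult_right_mono) auto
      then show False using upper total k(2) k0 by (simp add: l_def)
    qed
    \<comment> \<open>A nonzero copy number makes the bound \<open>s / 3 \<le> t\<close> strict; for
      \<open>s = 3\<close> the weak bound gives only \<open>1 \<le> t\<close>, which is no
      overflow.\<close>
    then obtain l where l: "l < Suc i" "k l \<noteq> 0"
      unfolding s_def by (metis (no_types, lifting) lessThan_iff not_numeral_le_zero sum.neutral)
    have "real s * (1 / 3) < t"
      unfolding s_def t_def of_nat_sum sum_distrib_right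
    proof (intro sum_strict_mono_ex1 ballI bexI[of _ l])
      show "real (k j) * (1 / 3) \<le> real (k j) * ?x j" for j
        using b(1)[of j] by (intro mult_left_mono) auto
      show "real (k l) * (1 / 3) < real (k l) * ?x l"
        using b(1)[of l] l by (intro mult_strict_left_mono) auto
    qed (use l in auto)
    then show False using \<open>s \<ge> 3\<close> total k(1) k0 by (simp add: l_def)
  qed
  ultimately have k1: "k (Suc i) = 1" by simp
  then have t_le: "t \<le> ?x i" using total k(1) by (simp add: l_def)
  have "s \<noteq> 0"
  proof
    assume "s = 0"
    then have "t \<le> 0" using upper by simp
    then show False using total k(2) k1 b(1)[of i] d(1) by (simp add: l_def)
  qed
  have item: "real (k l) * ?x l \<le> t" if "l \<le> i" for l
    unfolding t_def using that b(1) by (intro member_le_sum[where f = "\<lambda>j. real (k j) * ?x j"])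
      (auto intro!: mult_nonneg_nonneg less_imp_le[OF pos])
  have smaller: "k l = 0" if "l < i" for l
  proof (rule ccontr)
    assume "k l \<noteq> 0"
    then have "1 * ?x l \<le> real (k l) * ?x l" using b(1)[of l] by (intro mult_right_mono) auto
    then show False using item[of l] that t_le hard_size_less[OF d(1) that] by simp
  qed
  then have "s = k i" by (simp add: s_def)
  then have "k i \<noteq> 0" using \<open>s \<noteq> 0\<close> by simp
  \<comment> \<open>Here \<open>k i / 3 \<le> t \<le> 1 / 3 + d \<le> 5 / 12\<close>.\<close>
  moreover have "k i < 2"
    using lower t_le b(2)[of i] d(2) \<open>s = k i\<close> by simp
  ultimately show ?thesis using smaller j by (cases "j = i") auto
qed

lemma packing_hard_instance_0:
  assumes d: "0 < d" and k: "total (hard_instance d 0) k \<le> 1" "hard_size d 0 < total (hard_instance d 0) k"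
  shows "k 0 = 2"
proof -
  note b = hard_size_bounds(1)[OF d, of 0]
  have k': "real (k 0) * hard_size d 0 \<le> 1" "1 * hard_size d 0 < real (k 0) * hard_size d 0"
    using k by (simp_all add: total_def)
  have "1 < k 0" using k'(2) b by (subst (asm) mult_less_cancel_right_pos) auto
  moreover have "k 0 < 3"
  proof (rule ccontr)
    assume "\<not> k 0 < 3"
    then have "3 * hard_size d 0 \<le> real (k 0) * hard_size d 0" using b by (intro mult_right_mono) auto
    then show False using k'(1) b by linarith
  qed
  ultimately show ?thesis by simp
qed

lemma opt_hard_instance:
  assumes "0 < d" "d \<le> 1 / 12"
  shows "opt (hard_instance d 0) \<ge> 2 * hard_size d 0" "opt (hard_instance d (Suc i)) \<ge> 1"
proof -
  note v = valid_hard_instance[OF assms]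
  have "2 * hard_size d 0 \<le> 1" using hard_size_bounds(2)[OF assms(1), of 0] assms(2) by linarith
  then show "opt (hard_instance d 0) \<ge> 2 * hard_size d 0"
    using total_le_opt[OF v[of 0], of "\<lambda>_. 2"] by (simp add: total_def)
  let ?k = "\<lambda>j. if j = i \<or> j = Suc i then 1 else 0 :: nat"
  have "total (hard_instance d (Suc i)) ?k =
      (\<Sum>j<Suc i. if j = i then hard_size d j else 0) + (1 - hard_size d i)"
    unfolding total_def length_hard_instance
    by (subst sum.lessThan_Suc, subst nth_hard_instance_last,
        rule arg_cong2[where f = "(+)", OF sum.cong])
      (auto simp: nth_hard_instance
        simp del: hard_instance.simps sum.lessThan_Suc)
  also have "\<dots> = 1" by simp
  finally show "opt (hard_instance d (Suc i)) \<ge> 1"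
    using total_le_opt[OF v[of "Suc i"], of ?k] by simp
qed

text \<open>\<open>forced i j\<close> is the number of copies of item \<open>j\<close> that a ratio below 3/2 forces on hard
  instance \<open>i\<close>; it does not cover the complementary last item.\<close>

definition forced :: "nat \<Rightarrow> nat \<Rightarrow> nat" where
  "forced i j = (if i = 0 then 2 else if Suc j = i then 1 else 0)"

text \<open>The second condition on \<open>c\<close> says that gain at most
  \<open>2 / 3 + 2 * d\<close> is too little against optimum 1; the first handles instance
  0.\<close>

lemma packed_hard_instance:
  assumes d: "0 < d" "d \<le> 1 / 12" and c: "c < 3 / 2" "c * (2 / 3 + 2 * d) < 1"
    and feasible: "gain A \<phi> (hard_instance d i) \<le> 1"
    and ratio: "ratio_on A \<phi> (hard_instance d i) \<le> ereal c"
    and j: "j < max 1 i"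
  shows "packed A \<phi> (hard_instance d i) j = forced i j"
proof -
  let ?g = "gain A \<phi> (hard_instance d i)"
  note v = valid_hard_instance[OF d]
  note o = opt_hard_instance[OF d]
  note b = hard_size_bounds(1)[OF d(1), of 0]
  have "0 < opt (hard_instance d i)"
    using o(1) b less_le_trans[OF zero_less_one o(2)]
    by (cases i) (auto simp del: hard_instance.simps)
  note g = opt_le_of_ratio_le[OF ratio this gain_nonneg[OF v]]
  have g': "c * ?g \<le> 3 / 2 * ?g" using c(1) g(2) by (intro mult_right_mono) auto
  show ?thesis
  proof (cases i)
    case 0
    \<comment> \<open>The optimum is at least twice the item size and at most 3/2 of the gain, so
      the gain is at least 4/3 of the item size.\<close>
    have "hard_size d 0 < ?g" using g(1) g' o(1) b unfolding 0 by linarith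
    then show ?thesis
      using packing_hard_instance_0[OF d(1)] feasible j unfolding gain_def 0 forced_def by simp
  next
    case (Suc l)
    have "1 \<le> c * ?g" using g(1) o(2)[of l] Suc by simp
    then have "c * (2 / 3 + 2 * d) < c * ?g" using c(2) by linarith
    moreover have "0 < c"
      using \<open>1 \<le> c * ?g\<close> g(2) by (metis less_le_trans zero_less_mult_pos2 zero_less_one)
    ultimately have "2 / 3 + 2 * d < ?g" by simp
    then show ?thesis
      using packing_hard_instance_Suc[OF d, of l "packed A \<phi> (hard_instance d i)" j] feasible j
      unfolding gain_def Suc forced_def by (auto simp del: hard_instance.simps)
  qed
qed

section \<open>Pigeonhole argument over advice prefixes\<close>

lemma advice_lower_bound:
  assumes n: "2 \<le> n" and alg: "online_algorithm_with_advice A orc"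
    and ratio: "competitive_ratio_within {xs. valid_instance xs \<and> length xs \<le> n} A orc < ereal (3 / 2)"
  shows "\<exists>xs. valid_instance xs \<and> length xs \<le> n \<and>
           log 2 (real n - 1) < real (bits_read A (orc xs) xs)"
proof (rule ccontr)
  assume "\<not> ?thesis"
  then have few: "real (bits_read A (orc xs) xs) \<le> log 2 (real n - 1)"
    if "valid_instance xs" "length xs \<le> n" for xs
    using that by (meson not_less)
  \<comment> \<open>All runs on short instances read at most \<open>b\<close> bits, and
    \<open>2 ^ b \<le> n - 1\<close> leaves fewer advice prefixes than the \<open>n\<close> hard
    instances.\<close>
  define b where "b = nat \<lfloor>log 2 (real n - 1)\<rfloor>"
  have "0 \<le> log 2 (real n - 1)" using n by simp
  then have "real b \<le> log 2 (real n - 1)" unfolding b_def by simp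
  then have "2 powr real b \<le> real n - 1" using n by (simp add: le_log_iff)
  then have "real (2 ^ b) < real n" by (simp only: powr_realpow[OF zero_less_numeral] of_nat_power of_nat_numeral)
  then have b: "2 ^ b < n" by (simp only: of_nat_less_iff)

  obtain c where c: "competitive_ratio_within {xs. valid_instance xs \<and> length xs \<le> n} A orc < ereal c"
      "c < 3 / 2"
    using ereal_dense2[OF ratio] by auto
  \<comment> \<open>The bound 1/12 serves the geometry of the hard instances. The other gives
    \<open>2 * c / 3 + 6 * d \<le> 1\<close>, while \<open>c < 3 / 2\<close> gives
    \<open>c * (2 / 3 + 2 * d) \<le> 2 * c / 3 + 3 * d\<close>.\<close>
  define d where "d = min (1 / 12) ((1 - 2 * c / 3) / 6)"
  have d: "0 < d" "d \<le> 1 / 12" using c(2) by (auto simp: d_def)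
  have cd: "c * (2 / 3 + 2 * d) < 1"
  proof -
    have "c * (2 / 3 + 2 * d) = 2 * c / 3 + c * (2 * d)" by (simp add: algebra_simps)
    also have "\<dots> \<le> 2 * c / 3 + 3 / 2 * (2 * d)"
      using c(2) d(1) by (intro add_left_mono mult_right_mono) auto
    also have "\<dots> < 1"
    proof -
      have "d \<le> (1 - 2 * c / 3) / 6" unfolding d_def by (rule min.cobounded2)
      then have "6 * d \<le> 1 - 2 * c / 3" by (simp add: field_simps)
      then show ?thesis using d(1) by (simp add: field_simps)
    qed
    finally show ?thesis .
  qed

  let ?I = "hard_instance d"
  let ?T = "\<lambda>i. orc (?I i)"
  note v = valid_hard_instance[OF d]
  have runs: "halts A (?T i) (?I i)" "gain A (?T i) (?I i) \<le> 1" for i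
    using alg v unfolding online_algorithm_with_advice_def by blast+
  have bits: "bits_read A (?T i) (?I i) \<le> b" if "i < n" for i
    unfolding b_def using few[OF v, of i] that by (simp add: length_hard_instance le_nat_floor)
  have ratio_le: "ratio_on A (?T i) (?I i) \<le> ereal c" if "i < n" for i
  proof -
    have "ratio_on A (?T i) (?I i)
        \<le> competitive_ratio_within {xs. valid_instance xs \<and> length xs \<le> n} A orc"
      unfolding competitive_ratio_within_def
      by (rule SUP_upper) (use v that in \<open>simp add: length_hard_instance\<close>)
    then show ?thesis using c(1) by simp
  qed
  have packed: "packed A (?T i) (?I i) j = forced i j" if "i < n" "j < max 1 i" for i j
    using packed_hard_instance[OF d c(2) cd runs(2) ratio_le] that by blast

  let ?adv = "\<lambda>i. map (?T i) [0..<b]"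
  have "card (?adv ` {..<n}) \<le> card {bs :: bool list. set bs \<subseteq> UNIV \<and> length bs = b}"
    by (intro card_mono finite_lists_length_eq) auto
  also have "\<dots> = 2 ^ b" by (subst card_lists_length_eq) auto
  also have "\<dots> < card {..<n}" using b by simp
  finally have "\<not> inj_on ?adv {..<n}" by (rule pigeonhole)
  then obtain i j where ij: "i < j" "j < n" "?adv i = ?adv j"
    unfolding inj_on_def by (metis lessThan_iff linorder_neqE_nat)
  \<comment> \<open>Position \<open>l\<close> is the last one before the complement of instance
    \<open>i\<close>, and position 0 if \<open>i = 0\<close> by truncated subtraction. It lies in
    the common prefix. Instance \<open>i\<close> forces 2 copies there if \<open>i = 0\<close> and 1
    otherwise; instance \<open>j\<close> forces at most 1 in the first case and 0 in the
    second.\<close>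
  define l where "l = i - 1"
  have l: "Suc l = max 1 i" by (simp add: l_def)
  have "packed A (?T i) (?I i) l = packed A (?T j) (?I j) l"
    using ij l take_hard_instance[OF ij(1), of d]
    by (intro packed_cong[where b = b] runs bits) (auto simp: length_hard_instance)
  then have "forced i l = forced j l" using packed ij l by simp
  then show False using ij(1) l by (auto simp: forced_def split: if_splits)
qed

lemma constant_advice_lower_bound:
  assumes "online_algorithm_with_advice A orc" "uses_advice_bits A orc (\<lambda>_. k)"
  shows "ereal (3 / 2) \<le> competitive_ratio A orc"
proof (rule ccontr)
  assume less: "\<not> ?thesis"
  \<comment> \<open>This choice makes \<open>log 2 (n - 1)\<close> exactly \<open>k\<close>.\<close>
  define n :: nat where "n = 2 ^ k + 1"
  have "competitive_ratio_within {xs. valid_instance xs \<and> length xs \<le> n} A orc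
      \<le> competitive_ratio A orc"
    unfolding competitive_ratio_def competitive_ratio_within_def by (intro SUP_subset_mono) auto
  also have "\<dots> < ereal (3 / 2)" using less by simp
  finally obtain xs where xs: "valid_instance xs" "log 2 (real n - 1) < real (bits_read A (orc xs) xs)"
    using advice_lower_bound[OF _ assms(1), of n] by (auto simp: n_def)
  have "log 2 (real n - 1) = real k" by (simp add: n_def)
  moreover have "bits_read A (orc xs) xs \<le> k"
    using assms(2) xs(1) unfolding uses_advice_bits_def by blast
  ultimately show False using xs(2) by simp
qed

theorem theorem5:
  shows "(\<exists>A orc. online_algorithm_with_advice A orc \<and> uses_advice_bits A orc (\<lambda>_. 1) \<and>
            competitive_ratio A orc \<le> ereal (3/2)) \<and>
         (\<forall>k::nat. k > 0 \<longrightarrow>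
            \<not> (\<exists>A orc. online_algorithm_with_advice A orc \<and> uses_advice_bits A orc (\<lambda>_. k) \<and>
                 competitive_ratio A orc < ereal (3/2))) \<and>
         (\<forall>n::nat. n \<ge> 2 \<longrightarrow>
            (\<forall>A orc. online_algorithm_with_advice A orc \<and>
               competitive_ratio_within {xs. valid_instance xs \<and> length xs \<le> n} A orc
                 < ereal (3/2) \<longrightarrow>
               (\<exists>xs. valid_instance xs \<and> length xs \<le> n \<and>
                  log 2 (real n - 1) < real (bits_read A (orc xs) xs))))"
proof (intro conjI allI impI)
  show "\<exists>A orc. online_algorithm_with_advice A orc \<and> uses_advice_bits A orc (\<lambda>_. 1) \<and>
      competitive_ratio A orc \<le> ereal (3/2)"
    by (rule one_bit_upper_bound)
next
  fix k :: nat
  show "\<not> (\<exists>A orc. online_algorithm_with_advice A orc \<and> uses_advice_bits A orc (\<lambda>_. k) \<and>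
      competitive_ratio A orc < ereal (3/2))"
    using constant_advice_lower_bound leD by blast
next
  fix n :: nat and A orc
  assume "2 \<le> n" "online_algorithm_with_advice A orc \<and>
    competitive_ratio_within {xs. valid_instance xs \<and> length xs \<le> n} A orc < ereal (3/2)"
  then show "\<exists>xs. valid_instance xs \<and> length xs \<le> n \<and>
      log 2 (real n - 1) < real (bits_read A (orc xs) xs)"
    by (intro advice_lower_bound) auto
qed

end
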